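(* Let $S\subset\mathbb{Z}^d$ be finite (possibly containing $0$), $\mathcal{P}=\{P_\alpha\}_{\alpha\in S}$ a resolution of unity on $\mathbb{C}^D$, and $C$ a $D\times D$ unitary matrix with $C^2=I$ that is not a scalar multiple of the identity. Then: (a) $U(S,\mathcal{P},C)$ has eigenvalue $1$ if and only if for each $z\in T^d\setminus E$ there is a nonzero $\psi\in\mathcal{E}(1)$ with $\eta(z)\psi\in\mathcal{E}(-1)$; (b) $U(S,\mathcal{P},C)$ has eigenvalue $-1$ if and only if for each $z\in T^d\setminus E$ there is a nonzero $\psi\in\mathcal{E}(-1)$ with $\eta(z)\psi\in\mathcal{E}(1)$.
   Context: A resolution of unity: orthogonal projections $P_\alpha$ on $\mathbb{C}^D$, $P_\alpha P_\beta=0$ ($\alpha\neq\beta$), $\sum_\alpha P_\alpha=I$. $(\tau^\alpha f)(x)=f(x-\alpha)$ on $\ell^2(\mathbb{Z}^d,\mathbb{C}^D)$, $U(S,\mathcal{P},C)=\big(\sum_{\alpha\in S}\tau^\alpha P_\alpha\big)C$ with $C$ acting pointwise; eigenvalue means point spectrum. $T^d=\{z\in\mathbb{C}^d:|z_j|=1\}$, $z^\alpha=\prod z_j^{\alpha_j}$. $\mathcal{E}(\pm1)$ are the eigenspaces of $C$ for $\pm1$. $E=\bigcup_{\alpha\in S}\{z\in T^d:z^\alpha=-1\}$ and, for $z\in T^d\setminus E$, $\eta(z)=\sum_{\alpha\in S}\frac{1-z^\alpha}{1+z^\alpha}P_\alpha$. *)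

theory Defs
  imports "HOL-Analysis.Analysis"
begin

text \<open>Lattice Z^d = int^'d, internal space C^D = complex^'n, D x D matrices complex^'n^'n.\<close>

definition cadj :: "complex^'n^'n \<Rightarrow> complex^'n^'n" where
  "cadj M = (\<chi> i j. cnj (M $ j $ i))"

definition unitary_mat :: "complex^'n^'n \<Rightarrow> bool" where
  "unitary_mat M \<longleftrightarrow> cadj M ** M = mat 1 \<and> M ** cadj M = mat 1"

definition orth_proj :: "complex^'n^'n \<Rightarrow> bool" where
  "orth_proj P \<longleftrightarrow> P ** P = P \<and> cadj P = P"

definition resolution_of_unity :: "(int^'d) set \<Rightarrow> (int^'d \<Rightarrow> complex^'n^'n) \<Rightarrow> bool" where
  "resolution_of_unity S P \<longleftrightarrow>
     (\<forall>a\<in>S. orth_proj (P a)) \<and>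
     (\<forall>a\<in>S. \<forall>b\<in>S. a \<noteq> b \<longrightarrow> P a ** P b = 0) \<and>
     (\<Sum>a\<in>S. P a) = mat 1"

definition ell2 :: "(int^'d \<Rightarrow> complex^'n) set" where
  "ell2 = {f. (\<lambda>x. (norm (f x))\<^sup>2) summable_on UNIV}"

definition shift :: "int^'d \<Rightarrow> (int^'d \<Rightarrow> 'b) \<Rightarrow> (int^'d \<Rightarrow> 'b)" where
  "shift a f = (\<lambda>x. f (x - a))"

definition qwalk :: "(int^'d) set \<Rightarrow> (int^'d \<Rightarrow> complex^'n^'n) \<Rightarrow> complex^'n^'n
    \<Rightarrow> (int^'d \<Rightarrow> complex^'n) \<Rightarrow> (int^'d \<Rightarrow> complex^'n)" where
  "qwalk S P C f = (\<lambda>x. \<Sum>a\<in>S. shift a (\<lambda>y. P a *v (C *v f y)) x)"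

definition has_eigenvalue :: "((int^'d \<Rightarrow> complex^'n) \<Rightarrow> (int^'d \<Rightarrow> complex^'n)) \<Rightarrow> complex \<Rightarrow> bool" where
  "has_eigenvalue U lam \<longleftrightarrow> (\<exists>f\<in>ell2. f \<noteq> (\<lambda>_. 0) \<and> U f = (\<lambda>x. lam *s f x))"

definition torus :: "(complex^'d) set" where
  "torus = {z. \<forall>j. norm (z $ j) = 1}"

definition zpow :: "complex^'d \<Rightarrow> int^'d \<Rightarrow> complex" where
  "zpow z a = (\<Prod>j\<in>UNIV. (z $ j) powi (a $ j))"

definition Eset :: "(int^'d) set \<Rightarrow> (complex^'d) set" where
  "Eset S = (\<Union>a\<in>S. {z\<in>torus. zpow z a = -1})"

definition eta :: "(int^'d) set \<Rightarrow> (int^'d \<Rightarrow> complex^'n^'n) \<Rightarrow> complex^'d \<Rightarrow> complex^'n^'n" where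
  "eta S P z = (\<chi> i k. \<Sum>a\<in>S. ((1 - zpow z a) / (1 + zpow z a)) * (P a $ i $ k))"

definition eigsp :: "complex^'n^'n \<Rightarrow> complex \<Rightarrow> (complex^'n) set" where
  "eigsp C lam = {v. C *v v = lam *s v}"

end

theory Submission
  imports Defs
begin

text \<open>
  An eigenfunction for \<open>\<lambda>\<close> is an element of the kernel of a finite-range convolution operator with
  matrix symbol \<open>M z = (\<Sum>a\<in>S. zpow z a *s P a) C - \<lambda>\<close>. Fourier analysis is replaced by counting
  in large boxes: if the restrictions to a box of solutions span a space of dimension proportional to the
  volume, some combination vanishes on a boundary layer, and cutting it off outside
  the box leaves a finitely supported solution.

  From an \<open>\<ell>\<^sup>2\<close> solution \<open>f\<close>, the translates of \<open>f\<close> span enough dimensions because the Toeplitz matrix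
  \<open>f (x - b) $ i\<close> has rank at least \<open>\<bar>trace\<bar>\<^sup>2 / (Hilbert-Schmidt norm)\<^sup>2\<close>; the finitely
  supported solution has a trigonometric polynomial as transform, so \<open>M z\<close> is singular everywhere.
  Conversely, if \<open>M z\<close> is singular at all \<open>N\<close>-th roots of unity, the plane waves at these points are
  \<open>N\<^sup>d\<close> independent periodic solutions. Taking \<open>N\<close> odd avoids the exceptional set \<open>E\<close>.

  Finally \<open>\<eta>(z)\<close> is the Cayley transform of \<open>V = (\<Sum>a\<in>S. zpow z a *s P a)\<close>: for \<open>u = C v\<close> the equation
  \<open>V C v = \<lambda> v\<close> reads \<open>V u = \<lambda> C u\<close>, and \<open>\<psi> = u + V u\<close>, \<open>\<eta>(z) \<psi> = u - V u\<close> are the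
  components of \<open>2 u\<close> in the eigenspaces of \<open>C\<close> for \<open>\<lambda>\<close> and \<open>-\<lambda>\<close>.
\<close>

section \<open>Rank of a finite matrix via trace and Hilbert-Schmidt norm\<close>

text \<open>The hypothesis says that the rank of \<open>A\<close> is at most \<open>card M\<close>.\<close>
lemma trace_rank_bound:
  fixes A :: "'a \<Rightarrow> 'a \<Rightarrow> complex" and w :: "'m \<Rightarrow> 'a \<Rightarrow> complex"
  assumes "finite M" "finite F"
    and "\<And>c x. (\<And>m. m \<in> M \<Longrightarrow> (\<Sum>b\<in>F. w m b * c b) = 0) \<Longrightarrow> x \<in> F \<Longrightarrow> (\<Sum>b\<in>F. A x b * c b) = 0"
  shows "(cmod (\<Sum>x\<in>F. A x x))\<^sup>2 \<le> card M * (\<Sum>x\<in>F. \<Sum>b\<in>F. (cmod (A x b))\<^sup>2)"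
  using assms(1,3)
proof (induction M arbitrary: A w rule: finite_induct)
  case empty
  have "A x x = 0" if "x \<in> F" for x
    using empty.prems[of "\<lambda>b. if b = x then 1 else 0" x] that assms(2)
    by (simp add: if_distrib [of "times _"] cong: if_cong)
  then show ?case by simp
next
  case (insert m0 M)
  define H where "H = (\<Sum>x\<in>F. \<Sum>b\<in>F. (cmod (A x b))\<^sup>2)"
  have H0: "H \<ge> 0" unfolding H_def by (intro sum_nonneg) auto
  define s where "s = (\<Sum>b\<in>F. (cmod (w m0 b))\<^sup>2)"
  have s0: "s \<ge> 0" unfolding s_def by (intro sum_nonneg) auto
  show ?case
  proof (cases "s = 0")
    \<comment> \<open>The functional \<open>w m0\<close> vanishes on \<open>F\<close>, so it imposes
      no condition and the bound for \<open>M\<close> alone suffices.\<close>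
    case True
    then have z: "w m0 b = 0" if "b \<in> F" for b
      using that assms(2) unfolding s_def by (subst (asm) sum_nonneg_eq_0_iff) auto
    have "(cmod (\<Sum>x\<in>F. A x x))\<^sup>2 \<le> card M * H"
      unfolding H_def by (rule insert.IH[of w]) (rule insert.prems, auto simp: z)
    also have "\<dots> \<le> card (insert m0 M) * H"
      using H0 insert.hyps by (intro mult_right_mono) auto
    finally show ?thesis unfolding H_def .
  next
    case False
    \<comment> \<open>Split off the component of the rows of \<open>A\<close> along the first functional.\<close>
    define u where "u b = w m0 b / sqrt s" for b
    have u1: "(\<Sum>b\<in>F. u b * cnj (u b)) = 1"
    proof -
      have "(\<Sum>b\<in>F. u b * cnj (u b)) = (\<Sum>b\<in>F. of_real ((cmod (w m0 b))\<^sup>2) / of_real s)"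
        using s0 unfolding u_def
        by (intro sum.cong) (auto simp: complex_norm_square[symmetric] simp flip: of_real_mult)
      also have "\<dots> = of_real s / of_real s"
        by (simp only: sum_divide_distrib[symmetric] of_real_sum[symmetric] s_def[symmetric])
      finally show ?thesis using False by simp
    qed
    define y where "y x = (\<Sum>b\<in>F. A x b * cnj (u b))" for x
    define A' where "A' x b = A x b - y x * u b" for x b
    define p where "p m = (\<Sum>b\<in>F. w m b * cnj (u b))" for m
    define w' where "w' m b = w m b - p m * u b" for m b
    have IH: "(cmod (\<Sum>x\<in>F. A' x x))\<^sup>2 \<le> card M * (\<Sum>x\<in>F. \<Sum>b\<in>F. (cmod (A' x b))\<^sup>2)"
    proof (rule insert.IH[of w'])
      fix c x assume c: "\<And>m. m \<in> M \<Longrightarrow> (\<Sum>b\<in>F. w' m b * c b) = 0" and x: "x \<in> F"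
      define q where "q = (\<Sum>b\<in>F. u b * c b)"
      \<comment> \<open>Removing from \<open>c\<close> its component along the conjugate of
        \<open>u\<close> gives a vector killed by \<open>u\<close>. Pairing \<open>w' m\<close> or a
        row of \<open>A'\<close> with \<open>c\<close> is the same as pairing \<open>w m\<close> or
        the row of \<open>A\<close> with \<open>c'\<close>, so the hypothesis on \<open>A\<close>
        carries over to \<open>A'\<close>.\<close>
      define c' where "c' b = c b - q * cnj (u b)" for b
      have *: "(\<Sum>b\<in>F. v b * c' b) = (\<Sum>b\<in>F. v b * c b) - q * (\<Sum>b\<in>F. v b * cnj (u b))" for v
        unfolding c'_def by (simp add: algebra_simps sum_subtractf sum_distrib_left)
      have **: "(\<Sum>b\<in>F. (v b - k * u b) * c b) = (\<Sum>b\<in>F. v b * c b) - k * q" for v k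
        unfolding q_def by (simp add: algebra_simps sum_subtractf sum_distrib_left)
      have "(\<Sum>b\<in>F. A x b * c' b) = 0"
      proof (rule insert.prems[OF _ x])
        fix m assume "m \<in> insert m0 M"
        then consider "m = m0" | "m \<in> M" by auto
        then show "(\<Sum>b\<in>F. w m b * c' b) = 0"
        proof cases
          case 1
          have "(\<Sum>b\<in>F. u b * c' b) = 0"
            unfolding * u1 by (simp add: q_def)
          moreover have "(\<Sum>b\<in>F. w m0 b * c' b) = sqrt s * (\<Sum>b\<in>F. u b * c' b)"
            unfolding u_def using False s0 by (simp add: sum_distrib_left)
          ultimately show ?thesis using 1 by simp
        next
          case 2
          then show ?thesis using c[OF 2] unfolding * w'_def ** p_def by (simp add: mult.commute)
        qed
      qed
      then show "(\<Sum>b\<in>F. A' x b * c b) = 0"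
        unfolding * A'_def ** y_def by (simp add: mult.commute)
    qed
    define H' where "H' = (\<Sum>x\<in>F. \<Sum>b\<in>F. (cmod (A' x b))\<^sup>2)"
    define Y where "Y = (\<Sum>x\<in>F. (cmod (y x))\<^sup>2)"
    have H'0: "H' \<ge> 0" "Y \<ge> 0" unfolding H'_def Y_def by (auto intro!: sum_nonneg)
    have row: "(\<Sum>b\<in>F. (cmod (A x b))\<^sup>2) = (\<Sum>b\<in>F. (cmod (A' x b))\<^sup>2) + (cmod (y x))\<^sup>2" for x
    proof -
      have "of_real (\<Sum>b\<in>F. (cmod (A' x b))\<^sup>2) = (\<Sum>b\<in>F. A' x b * cnj (A' x b))"
        by (simp only: of_real_sum complex_norm_square)
      also have "\<dots> = (\<Sum>b\<in>F. A x b * cnj (A x b)) - cnj (y x) * (\<Sum>b\<in>F. A x b * cnj (u b))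
          - y x * (\<Sum>b\<in>F. cnj (A x b) * u b) + y x * cnj (y x) * (\<Sum>b\<in>F. u b * cnj (u b))"
        unfolding A'_def by (simp add: algebra_simps sum_subtractf sum.distrib sum_distrib_left)
      also have "(\<Sum>b\<in>F. A x b * cnj (u b)) = y x" by (simp add: y_def)
      also have "(\<Sum>b\<in>F. cnj (A x b) * u b) = cnj (y x)" by (simp add: y_def)
      also have "(\<Sum>b\<in>F. A x b * cnj (A x b)) = of_real (\<Sum>b\<in>F. (cmod (A x b))\<^sup>2)"
        by (simp only: of_real_sum complex_norm_square)
      finally have "complex_of_real (\<Sum>b\<in>F. (cmod (A' x b))\<^sup>2) =
          of_real ((\<Sum>b\<in>F. (cmod (A x b))\<^sup>2) - (cmod (y x))\<^sup>2)"
        using complex_norm_square[of "y x"] by (simp add: u1 mult.commute)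
      then show ?thesis unfolding of_real_eq_iff by simp
    qed
    have HH: "H = H' + Y" unfolding H_def H'_def Y_def row by (simp add: sum.distrib)
    have tr: "(\<Sum>x\<in>F. A x x) = (\<Sum>x\<in>F. A' x x) + (\<Sum>x\<in>F. y x * u x)"
      unfolding A'_def by (simp add: sum_subtractf)
    have "cmod (\<Sum>x\<in>F. y x * u x) \<le> (\<Sum>x\<in>F. cmod (y x) * cmod (u x))"
      by (rule order_trans[OF norm_sum]) (simp add: norm_mult)
    also have "\<dots> \<le> sqrt Y * 1"
    proof -
      have "(\<Sum>x\<in>F. (cmod (u x))\<^sup>2) = 1"
        using u1 unfolding complex_norm_square[symmetric] by (metis of_real_eq_1_iff of_real_sum)
      then have "((\<Sum>x\<in>F. cmod (y x) * cmod (u x)))\<^sup>2 \<le> Y"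
        using Cauchy_Schwarz_ineq_sum[of "\<lambda>x. cmod (y x)" "\<lambda>x. cmod (u x)" F] by (simp add: Y_def)
      then show ?thesis by (simp add: real_le_rsqrt)
    qed
    finally have t2: "cmod (\<Sum>x\<in>F. y x * u x) \<le> sqrt Y" by simp
    have t1: "cmod (\<Sum>x\<in>F. A' x x) \<le> sqrt (card M) * sqrt H'"
      using IH real_le_rsqrt unfolding H'_def[symmetric] by (simp add: real_sqrt_mult[symmetric])
    have "cmod (\<Sum>x\<in>F. A x x) \<le> sqrt (card M) * sqrt H' + sqrt Y"
      unfolding tr using norm_triangle_le t1 t2 by (smt (verit))
    then have "(cmod (\<Sum>x\<in>F. A x x))\<^sup>2 \<le> (sqrt (card M) * sqrt H' + sqrt Y)\<^sup>2"
      by (intro power_mono) auto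
    \<comment> \<open>Cauchy-Schwarz in the plane, for the vectors (\<open>sqrt (card M)\<close>, 1)
      and (\<open>sqrt H'\<close>, \<open>sqrt Y\<close>), with its defect written as a
      square.\<close>
    also have "\<dots> = (card M + 1) * (H' + Y) - (sqrt H' - sqrt (card M) * sqrt Y)\<^sup>2"
      using H'0 by (simp add: power2_sum power2_diff power_mult_distrib algebra_simps)
    also have "\<dots> \<le> (card M + 1) * (H' + Y)" by simp
    finally show ?thesis using insert.hyps unfolding H_def[symmetric] HH by (simp add: add.commute)
  qed
qed

section \<open>Lattice boxes and their boundary layers\<close>

lemma card_vec_box:
  "card {x :: 'a^'d. \<forall>j. x $ j \<in> X} = card X ^ CARD('d)"
proof -
  have "bij_betw vec_nth {x :: 'a^'d. \<forall>j. x $ j \<in> X} (PiE UNIV (\<lambda>_. X))"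
    by (rule bij_betwI[where g = vec_lambda]) (auto simp: PiE_def)
  then have "card {x :: 'a^'d. \<forall>j. x $ j \<in> X} = card (PiE (UNIV :: 'd set) (\<lambda>_. X))"
    by (rule bij_betw_same_card)
  then show ?thesis by (simp add: card_PiE)
qed

lemma finite_vec_box:
  "finite X \<Longrightarrow> finite {x :: 'a^'d. \<forall>j. x $ j \<in> X}"
proof -
  assume "finite X"
  then have "finite (vec_lambda ` (PiE (UNIV :: 'd set) (\<lambda>_. X)))"
    by (intro finite_imageI finite_PiE) auto
  moreover have "{x :: 'a^'d. \<forall>j. x $ j \<in> X} \<subseteq> vec_lambda ` (PiE (UNIV :: 'd set) (\<lambda>_. X))"
    by (auto intro!: image_eqI[where x = "vec_nth _"])
  ultimately show ?thesis using finite_subset by blast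
qed

definition box :: "int \<Rightarrow> int \<Rightarrow> (int^'d) set" where
  "box l u = {x. \<forall>j. x $ j \<in> {l..<u}}"

lemma finite_box [simp]: "finite (box l u)"
  unfolding box_def by (rule finite_vec_box) simp

lemma card_box: "card (box l u :: (int^'d) set) = nat (u - l) ^ CARD('d)"
  unfolding box_def using card_vec_box[of "{l..<u}", where 'd = 'd] by (simp del: atLeastLessThan_iff)

text \<open>The width is \<open>2 * R\<close> because two points \<open>x - a\<close> and
  \<open>x - b\<close> differ by at most \<open>2 * R\<close> in each coordinate when the entries of
  \<open>a\<close> and \<open>b\<close> are bounded by \<open>R\<close>.\<close>

definition layer :: "int \<Rightarrow> int \<Rightarrow> (int^'d) set" where
  "layer R N = box 0 N - box (2 * R) (N - 2 * R)"

lemma finite_layer [simp]: "finite (layer R N)"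
  unfolding layer_def by simp

lemma card_layer:
  assumes "0 \<le> R" "4 * R \<le> N"
  shows "real (card (layer R N :: (int^'d) set)) = real_of_int N ^ CARD('d) - real_of_int (N - 4 * R) ^ CARD('d)"
proof -
  have sub: "(box (2 * R) (N - 2 * R) :: (int^'d) set) \<subseteq> box 0 N"
    using assms unfolding box_def by (auto, smt (verit), smt (verit))
  have "card (layer R N :: (int^'d) set) = card (box 0 N :: (int^'d) set) - card (box (2 * R) (N - 2 * R) :: (int^'d) set)"
    unfolding layer_def using sub by (intro card_Diff_subset) auto
  moreover have "card (box (2 * R) (N - 2 * R) :: (int^'d) set) \<le> card (box 0 N :: (int^'d) set)"
    using sub by (intro card_mono) auto
  ultimately show ?thesis using assms by (simp add: of_nat_diff card_box)
qed

text \<open>The ratio of surface to volume tends to 0. Oddness of the side is needed later, to keep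
  the roots of unity away from the exceptional set.\<close>

lemma small_layer:
  assumes "0 \<le> R" "\<epsilon> > 0"
  obtains N :: nat where "odd N" "real (card (layer R (int N) :: (int^'d) set)) < \<epsilon> * real N ^ CARD('d)"
proof -
  define d where "d = CARD('d)"
  have "((\<lambda>n. (1 - (1 - 4 * real_of_int R * inverse (real n)) ^ d)) \<longlongrightarrow> 1 - (1 - 4 * real_of_int R * 0) ^ d) sequentially"
    by (intro tendsto_intros lim_inverse_n)
  then have "\<forall>\<^sub>F n in sequentially. 1 - (1 - 4 * real_of_int R * inverse (real n)) ^ d < \<epsilon>"
    using assms(2) by (intro order_tendstoD(2)) auto
  then obtain n0 where n0: "\<And>n. n \<ge> n0 \<Longrightarrow> 1 - (1 - 4 * real_of_int R * inverse (real n)) ^ d < \<epsilon>"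
    unfolding eventually_sequentially by blast
  define N where "N = 2 * (n0 + nat (4 * R)) + 1"
  have N: "odd N" "N \<ge> n0" "4 * R \<le> int N" "N > 0" using assms(1) by (auto simp: N_def)
  have "real (card (layer R (int N) :: (int^'d) set)) = real N ^ d - (real N - 4 * R) ^ d"
    using card_layer[OF assms(1) N(3), where 'd = 'd] by (simp add: d_def)
  also have "real N - 4 * R = (1 - 4 * R * inverse (real N)) * real N"
    using N(4) by (simp add: field_simps)
  also have "real N ^ d - \<dots> ^ d = (1 - (1 - 4 * real_of_int R * inverse (real N)) ^ d) * real N ^ d"
    unfolding power_mult_distrib by (simp add: left_diff_distrib)
  also have "\<dots> < \<epsilon> * real N ^ d"
    using n0[OF N(2)] N(4) by (intro mult_strict_right_mono) auto
  finally show ?thesis using that N(1) unfolding d_def by blast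
qed


section \<open>Finitely supported solutions by counting in a box\<close>

definition conv_op :: "(int^'d) set \<Rightarrow> (int^'d \<Rightarrow> complex^'n^'n) \<Rightarrow> (int^'d \<Rightarrow> complex^'n) \<Rightarrow> int^'d \<Rightarrow> complex^'n" where
  "conv_op S Q f x = (\<Sum>a\<in>S. Q a *v f (x - a))"

lemma matrix_vector_mult_lincomb:
  fixes A :: "complex^'n^'m"
  shows "A *v (\<Sum>b\<in>B. c b *s v b) = (\<Sum>b\<in>B. c b *s (A *v v b))"
  by (simp add: vec.linear_sum[OF matrix_vector_mul_linear_gen] vector_scalar_commute)

lemma conv_op_lincomb:
  "conv_op S Q (\<lambda>x. \<Sum>b\<in>B. c b *s e b x) x = (\<Sum>b\<in>B. c b *s conv_op S Q (e b) x)"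
  unfolding conv_op_def matrix_vector_mult_lincomb
  by (subst sum.swap) (simp add: vec.scale_sum_right)

text \<open>If one of the points \<open>x - a\<close> lies in the inner box, all of them lie in the
  big box and the cutoff is invisible at \<open>x\<close>. Otherwise each of them is outside the big
  box or in the layer, where the truncated function vanishes.\<close>

lemma conv_op_truncate:
  assumes R: "\<And>a j. a \<in> S \<Longrightarrow> \<bar>a $ j\<bar> \<le> R"
    and g: "\<And>x. conv_op S Q g x = 0"
    and z: "\<And>x. x \<in> layer R N \<Longrightarrow> g x = 0"
  shows "conv_op S Q (\<lambda>x. if x \<in> box 0 N then g x else 0) x = 0"
proof (cases "\<exists>a\<in>S. x - a \<in> box (2 * R) (N - 2 * R)")
  case True
  then obtain a0 where a0: "a0 \<in> S" "x - a0 \<in> box (2 * R) (N - 2 * R)" by auto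
  have "x - a \<in> box 0 N" if "a \<in> S" for a
  proof -
    have "0 \<le> x $ j - a $ j \<and> x $ j - a $ j < N" for j
      using a0(2) R[OF a0(1), of j] R[OF that, of j] unfolding box_def
      by (simp, smt (verit))
    then show ?thesis by (simp add: box_def)
  qed
  then have "conv_op S Q (\<lambda>x. if x \<in> box 0 N then g x else 0) x = conv_op S Q g x"
    unfolding conv_op_def by (intro sum.cong) auto
  then show ?thesis using g by simp
next
  case False
  then have "(if x - a \<in> box 0 N then g (x - a) else 0) = 0" if "a \<in> S" for a
    using z[of "x - a"] that by (auto simp: layer_def)
  then show ?thesis unfolding conv_op_def by (intro sum.neutral) auto
qed

text \<open>The matrix \<open>A\<close> certifies that the restrictions of the \<open>e b\<close> to
  the box span many dimensions: by the last hypothesis it kills every relation between them. If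
  every combination vanishing on the layer were also killed by \<open>A\<close>, the number of layer
  coordinates would bound the rank of \<open>A\<close>, against the trace estimate. So some
  combination vanishes on the layer but not on the box, and its truncation is a nonzero
  solution.\<close>

lemma finite_support_solution:
  fixes e :: "'b \<Rightarrow> int^'d \<Rightarrow> complex^'n" and A :: "'b \<Rightarrow> 'b \<Rightarrow> complex"
  assumes R: "\<And>a j. a \<in> S \<Longrightarrow> \<bar>a $ j\<bar> \<le> R" and B: "finite B"
    and e: "\<And>b x. b \<in> B \<Longrightarrow> conv_op S Q (e b) x = 0"
    and rank: "real (card (layer R N :: (int^'d) set)) * CARD('n) * (\<Sum>x\<in>B. \<Sum>b\<in>B. (cmod (A x b))\<^sup>2)
        < (cmod (\<Sum>x\<in>B. A x x))\<^sup>2"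
    and A: "\<And>c b. (\<And>x. x \<in> box 0 N \<Longrightarrow> (\<Sum>b\<in>B. c b *s e b x) = 0) \<Longrightarrow> b \<in> B
        \<Longrightarrow> (\<Sum>b'\<in>B. A b b' * c b') = 0"
  obtains f where "finite {x. f x \<noteq> 0}" "f \<noteq> (\<lambda>_. 0)" "\<And>x. conv_op S Q f x = 0"
proof -
  define M where "M = (layer R N :: (int^'d) set) \<times> (UNIV :: 'n set)"
  define w where "w m b = e b (fst m) $ (snd m)" for m b
  have "finite M" by (simp add: M_def)
  moreover have "\<not> (cmod (\<Sum>x\<in>B. A x x))\<^sup>2 \<le> card M * (\<Sum>x\<in>B. \<Sum>b\<in>B. (cmod (A x b))\<^sup>2)"
    using rank by (simp add: M_def card_cartesian_product)
  ultimately obtain c b0 where c: "\<And>m. m \<in> M \<Longrightarrow> (\<Sum>b\<in>B. w m b * c b) = 0"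
    and b0: "b0 \<in> B" "(\<Sum>b\<in>B. A b0 b * c b) \<noteq> 0"
    using trace_rank_bound[of M B w A] B by blast
  define g where "g x = (\<Sum>b\<in>B. c b *s e b x)" for x
  define f where "f x = (if x \<in> box 0 N then g x else 0)" for x
  have g0: "conv_op S Q g x = 0" for x
    unfolding g_def conv_op_lincomb using e by simp
  have "g x = 0" if "x \<in> layer R N" for x
    using c[of "(x, _)"] that unfolding g_def w_def M_def
    by (simp add: vec_eq_iff mult.commute)
  then have "conv_op S Q f x = 0" for x
    unfolding f_def using conv_op_truncate[OF R g0] by blast
  moreover have "finite {x. f x \<noteq> 0}"
    by (rule finite_subset[of _ "box 0 N"]) (auto simp: f_def)
  moreover have "f \<noteq> (\<lambda>_. 0)"
  proof
    assume "f = (\<lambda>_. 0)"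
    then have "g x = 0" if "x \<in> box 0 N" for x using that by (metis f_def)
    then show False using A[of c, OF _ b0(1)] b0(2) unfolding g_def by blast
  qed
  ultimately show ?thesis using that by blast
qed

lemma finite_coord_bound:
  fixes S :: "(int^'d) set"
  assumes "finite S"
  obtains R where "R \<ge> 0" "\<And>a j. a \<in> S \<Longrightarrow> \<bar>a $ j\<bar> \<le> R"
proof
  define R where "R = (\<Sum>a\<in>S. \<Sum>j\<in>UNIV. \<bar>a $ j\<bar>)"
  show "R \<ge> 0" unfolding R_def by (intro sum_nonneg) auto
  fix a j assume "a \<in> S"
  have "\<bar>a $ j\<bar> \<le> (\<Sum>j\<in>UNIV. \<bar>a $ j\<bar>)" by (rule member_le_sum) auto
  also have "\<dots> \<le> R" unfolding R_def using \<open>a \<in> S\<close> assms by (intro member_le_sum) (auto intro: sum_nonneg)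
  finally show "\<bar>a $ j\<bar> \<le> R" .
qed

text \<open>The solutions fed into the counting are translates of \<open>f\<close>, and
  \<open>A\<close> is the Toeplitz matrix of one component of \<open>f\<close>. Each row has squared
  norm at most that of \<open>f\<close>, while the diagonal is a nonzero constant, so the rank bound
  grows like the volume of the box.\<close>

lemma finite_support_solution_of_ell2:
  fixes f :: "int^'d \<Rightarrow> complex^'n"
  assumes "finite S" "f \<in> ell2" "f \<noteq> (\<lambda>_. 0)" "\<And>x. conv_op S Q f x = 0"
  obtains h where "finite {x. h x \<noteq> 0}" "h \<noteq> (\<lambda>_. 0)" "\<And>x. conv_op S Q h x = 0"
proof -
  obtain y where "f y \<noteq> 0" using assms(3) by blast
  then obtain i where i: "f y $ i \<noteq> 0" by (auto simp: vec_eq_iff)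
  obtain R where R: "R \<ge> 0" "\<And>a j. a \<in> S \<Longrightarrow> \<bar>a $ j\<bar> \<le> R"
    using finite_coord_bound[OF assms(1)] by blast
  define n2 where "n2 = (\<Sum>\<^sub>\<infinity>x. (norm (f x))\<^sup>2)"
  have sm: "(\<lambda>x. (norm (f x))\<^sup>2) summable_on UNIV" using assms(2) by (simp add: ell2_def)
  have fin: "(\<Sum>x\<in>X. (norm (f x))\<^sup>2) \<le> n2" if "finite X" for X
    unfolding n2_def using that by (intro finite_sum_le_infsum[OF sm]) auto
  have "0 < (norm (f y))\<^sup>2" using \<open>f y \<noteq> 0\<close> by simp
  also have "\<dots> \<le> n2" using fin[of "{y}"] by simp
  finally have n2: "n2 > 0" .
  \<comment> \<open>This is the value at which the squared trace equals \<open>\<epsilon>\<close>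
    times the volume, times \<open>CARD('n)\<close>, times the bound for the squared Hilbert-Schmidt
    norm.\<close>
  define \<epsilon> where "\<epsilon> = (cmod (f y $ i))\<^sup>2 / (CARD('n) * n2)"
  have "\<epsilon> > 0" unfolding \<epsilon>_def using i n2 by simp
  then obtain N :: nat where N: "odd N" "real (card (layer R (int N) :: (int^'d) set)) < \<epsilon> * real N ^ CARD('d)"
    using small_layer[OF R(1)] by blast
  define F where "F = (box 0 (int N) :: (int^'d) set)"
  have cF: "real (card F) = real N ^ CARD('d)" by (simp add: F_def card_box)
  have Npos: "real N ^ CARD('d) > 0" using N(1) by (simp add: odd_pos)
  \<comment> \<open>The offset \<open>y\<close> puts the nonzero value \<open>f y\<close> on the
    diagonal.\<close>
  define e where "e b x = f (x - b + y)" for b x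
  have "(\<Sum>x\<in>F. \<Sum>b\<in>F. (cmod (e b x $ i))\<^sup>2) \<le> (\<Sum>x\<in>F. n2)"
  proof (rule sum_mono)
    fix x
    have "(\<Sum>b\<in>F. (cmod (e b x $ i))\<^sup>2) \<le> (\<Sum>b\<in>F. (norm (f (x - b + y)))\<^sup>2)"
      unfolding e_def by (intro sum_mono power_mono Finite_Cartesian_Product.norm_nth_le) auto
    also have "\<dots> = (\<Sum>u\<in>(\<lambda>b. x - b + y) ` F. (norm (f u))\<^sup>2)"
      by (subst sum.reindex) (auto simp: inj_on_def)
    also have "\<dots> \<le> n2" by (rule fin) (simp add: F_def)
    finally show "(\<Sum>b\<in>F. (cmod (e b x $ i))\<^sup>2) \<le> n2" .
  qed
  then have hs: "(\<Sum>x\<in>F. \<Sum>b\<in>F. (cmod (e b x $ i))\<^sup>2) \<le> real N ^ CARD('d) * n2"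
    by (simp add: cF)
  have "real (card (layer R (int N) :: (int^'d) set)) * CARD('n) * (\<Sum>x\<in>F. \<Sum>b\<in>F. (cmod (e b x $ i))\<^sup>2)
      \<le> real (card (layer R (int N) :: (int^'d) set)) * CARD('n) * (real N ^ CARD('d) * n2)"
    by (intro mult_left_mono hs) auto
  also have "\<dots> < (\<epsilon> * real N ^ CARD('d)) * CARD('n) * (real N ^ CARD('d) * n2)"
    using N(2) Npos n2 by (intro mult_strict_right_mono) auto
  also have "\<dots> = (real N ^ CARD('d) * cmod (f y $ i))\<^sup>2"
    unfolding \<epsilon>_def using n2 by (simp add: power2_eq_square)
  also have "\<dots> = (cmod (\<Sum>x\<in>F. e x x $ i))\<^sup>2"
    by (simp add: e_def norm_mult cF[symmetric])
  finally have rank: "real (card (layer R (int N) :: (int^'d) set)) * CARD('n) * (\<Sum>x\<in>F. \<Sum>b\<in>F. (cmod (e b x $ i))\<^sup>2)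
      < (cmod (\<Sum>x\<in>F. e x x $ i))\<^sup>2" .
  have e0: "conv_op S Q (e b) x = 0" for b x
    using assms(4)[of "x - b + y"] unfolding conv_op_def e_def by (simp add: algebra_simps)
  show ?thesis
  proof (rule finite_support_solution[OF R(2) _ e0 rank])
    fix c b assume "\<And>x. x \<in> box 0 (int N) \<Longrightarrow> (\<Sum>b\<in>F. c b *s e b x) = 0" "b \<in> F"
    then have "(\<Sum>b'\<in>F. c b' *s e b' b) $ i = 0" by (simp add: F_def)
    then show "(\<Sum>b'\<in>F. e b' b $ i * c b') = 0" by (simp add: mult.commute)
  qed (use that in \<open>auto simp: F_def\<close>)
qed

section \<open>Independence of characters and of exponentials\<close>

lemma zpow_add:
  assumes "\<And>j. z $ j \<noteq> 0"
  shows "zpow z (a + b) = zpow z a * zpow z b"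
  unfolding zpow_def by (simp add: power_int_add assms prod.distrib)

lemma zpow_0 [simp]: "zpow z 0 = 1"
  by (simp add: zpow_def)

lemma zpow_nonzero:
  assumes "\<And>j. z $ j \<noteq> 0"
  shows "zpow z a \<noteq> 0"
  unfolding zpow_def by (simp add: assms)

lemma zpow_axis: "zpow z (axis j 1) = z $ j"
proof -
  have "zpow z (axis j 1) = (\<Prod>k\<in>UNIV. if k = j then z $ k else 1)"
    unfolding zpow_def by (intro prod.cong) (auto simp: axis_def)
  then show ?thesis by simp
qed

text \<open>Dedekind's argument: replacing \<open>x\<close> by \<open>x + axis j 1\<close>
  multiplies the term of \<open>z\<close> by \<open>z $ j\<close>. Subtracting \<open>z0 $ j\<close>
  times the original relation removes \<open>z0\<close>, and some coordinate \<open>j\<close>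
  separates \<open>z\<close> from \<open>z0\<close>.\<close>

lemma zpow_independent:
  fixes v :: "complex^'d \<Rightarrow> complex"
  assumes "finite Z" "\<And>z j. z \<in> Z \<Longrightarrow> z $ j \<noteq> 0" "\<And>x. (\<Sum>z\<in>Z. v z * zpow z x) = 0" "z \<in> Z"
  shows "v z = 0"
  using assms
proof (induction Z arbitrary: v z rule: finite_induct)
  case (insert z0 Z)
  have "v z * (z $ j - z0 $ j) = 0" if "z \<in> Z" for z j
  proof (rule insert.IH[where v = "\<lambda>z. v z * (z $ j - z0 $ j)"])
    fix x
    have "(\<Sum>z\<in>insert z0 Z. v z * zpow z (x + axis j 1)) = (\<Sum>z\<in>insert z0 Z. v z * z $ j * zpow z x)"
      by (intro sum.cong refl) (simp add: zpow_add insert.prems(1) zpow_axis)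
    moreover have "(\<Sum>z\<in>insert z0 Z. z0 $ j * (v z * zpow z x)) = 0"
      unfolding sum_distrib_left[symmetric] insert.prems by simp
    ultimately have "(\<Sum>z\<in>insert z0 Z. v z * (z $ j - z0 $ j) * zpow z x) = 0"
      using insert.prems(2)[of "x + axis j 1"]
      by (simp only: algebra_simps sum_subtractf) (simp add: algebra_simps)
    then show "(\<Sum>z\<in>Z. v z * (z $ j - z0 $ j) * zpow z x) = 0"
      using insert.hyps by simp
  qed (use insert.prems that in auto)
  then have Z: "v z = 0" if "z \<in> Z" for z
    using that insert.hyps(2) by (metis mult_eq_0_iff right_minus_eq vec_eq_iff)
  have "v z0 = 0"
    using insert.prems(2)[of 0] insert.hyps Z by simp
  with Z insert.prems(3) show ?case by auto
qed simp

definition idot :: "real^'d \<Rightarrow> int^'d \<Rightarrow> real" where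
  "idot t x = (\<Sum>j\<in>UNIV. t $ j * of_int (x $ j))"

lemma idot_add_left: "idot (s + t) x = idot s x + idot t x"
  unfolding idot_def by (simp add: algebra_simps sum.distrib)

lemma idot_add_right: "idot t (x + y) = idot t x + idot t y"
  unfolding idot_def by (simp add: algebra_simps sum.distrib)

lemma idot_axis: "idot (axis j c) x = c * of_int (x $ j)"
proof -
  have "idot (axis j c) x = (\<Sum>k\<in>UNIV. if k = j then c * of_int (x $ k) else 0)"
    unfolding idot_def by (intro sum.cong) (auto simp: axis_def)
  then show ?thesis by simp
qed

lemma cis_neq_cis:
  assumes "s \<noteq> t" "\<bar>s - t\<bar> \<le> 1"
  shows "cis s \<noteq> cis t"
proof
  assume "cis s = cis t"
  then have "cis (s - t) = 1" by (simp add: cis_divide[symmetric])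
  then have "sin (s - t) = 0" by (metis cis.sel(2) one_complex.sel(2))
  moreover have "sin (s - t) \<noteq> 0"
  proof (cases "s > t")
    case True
    then show ?thesis using sin_gt_zero[of "s - t"] assms pi_gt3 by auto
  next
    case False
    then have "sin (t - s) > 0" using sin_gt_zero[of "t - s"] assms pi_gt3 by auto
    then show ?thesis using sin_minus[of "t - s"] by simp
  qed
  ultimately show False by simp
qed

text \<open>Elimination as in \<open>zpow_independent\<close>, except that the relation is known
  only near 0. Each induction step halves the neighbourhood to leave room for a small shift.\<close>

lemma trig_poly_vanish_local:
  fixes a :: "int^'d \<Rightarrow> complex"
  assumes "finite A" "\<epsilon> > 0"
    and "\<And>t. (\<And>j. \<bar>t $ j\<bar> < \<epsilon>) \<Longrightarrow> (\<Sum>x\<in>A. a x * cis (idot t x)) = 0" "x \<in> A"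
  shows "a x = 0"
  using assms
proof (induction A arbitrary: a \<epsilon> x rule: finite_induct)
  case (insert x0 A)
  have A: "a y = 0" if y: "y \<in> A" for y
  proof -
    obtain j where j: "y $ j \<noteq> x0 $ j" using y insert.hyps(2) by (metis vec_eq_iff)
    \<comment> \<open>The first bound keeps the shifted point in the \<open>\<epsilon>\<close>-cube;
      the second keeps the two phases within distance 1, so that \<open>cis_neq_cis\<close>
      separates them.\<close>
    define \<theta> where "\<theta> = min (\<epsilon> / 2) (1 / \<bar>real_of_int (y $ j) - of_int (x0 $ j)\<bar>)"
    have \<theta>: "0 < \<theta>" "\<theta> \<le> \<epsilon> / 2" "\<theta> * \<bar>real_of_int (y $ j) - of_int (x0 $ j)\<bar> \<le> 1"
      using insert.prems(1) j unfolding \<theta>_def by (auto simp: min_def field_simps)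
    \<comment> \<open>Shifting \<open>t\<close> by \<open>\<theta>\<close> in direction \<open>j\<close> and subtracting eliminates the term \<open>x0\<close>.\<close>
    have "a y * (cis (\<theta> * of_int (y $ j)) - cis (\<theta> * of_int (x0 $ j))) = 0"
    proof (rule insert.IH[where a = "\<lambda>x. a x * (cis (\<theta> * of_int (x $ j)) - cis (\<theta> * of_int (x0 $ j)))"
          and \<epsilon> = "\<epsilon> / 2"])
      fix t :: "real^'d" assume t: "\<And>j. \<bar>t $ j\<bar> < \<epsilon> / 2"
      have "\<bar>t $ k\<bar> < \<epsilon>" for k using t[of k] insert.prems(1) by simp
      then have 0: "(\<Sum>x\<in>insert x0 A. a x * cis (idot t x)) = 0"
        by (rule insert.prems(2))
      have "\<bar>(t + axis j \<theta>) $ k\<bar> < \<epsilon>" for k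
        using t[of k] \<theta> by (auto simp: axis_def)
      then have "(\<Sum>x\<in>insert x0 A. a x * cis (idot (t + axis j \<theta>) x)) = 0"
        by (rule insert.prems(2))
      then have "(\<Sum>x\<in>insert x0 A. a x * (cis (idot t x) * cis (\<theta> * of_int (x $ j)))) = 0"
        by (simp only: idot_add_left idot_axis cis_mult)
      moreover have "(\<Sum>x\<in>insert x0 A. cis (\<theta> * of_int (x0 $ j)) * (a x * cis (idot t x))) = 0"
        unfolding sum_distrib_left[symmetric] 0 by simp
      ultimately have "(\<Sum>x\<in>insert x0 A. a x * (cis (\<theta> * of_int (x $ j)) - cis (\<theta> * of_int (x0 $ j))) * cis (idot t x)) = 0"
        by (simp only: algebra_simps sum_subtractf) (simp add: algebra_simps)
      then show "(\<Sum>x\<in>A. a x * (cis (\<theta> * of_int (x $ j)) - cis (\<theta> * of_int (x0 $ j))) * cis (idot t x)) = 0"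
        using insert.hyps by simp
    qed (use insert.prems y in auto)
    moreover have "cis (\<theta> * of_int (y $ j)) \<noteq> cis (\<theta> * of_int (x0 $ j))"
    proof (rule cis_neq_cis)
      show "\<bar>\<theta> * of_int (y $ j) - \<theta> * of_int (x0 $ j)\<bar> \<le> 1"
        using \<theta> by (simp add: right_diff_distrib[symmetric] abs_mult)
    qed (use \<theta> j in auto)
    ultimately show ?thesis by simp
  qed
  have "a x0 = 0"
    using insert.prems(2)[of 0] insert.prems(1) insert.hyps A by simp
  with A insert.prems(3) show ?case by auto
qed simp

section \<open>Solutions force a singular symbol\<close>

text \<open>The transform with a multiplicative \<open>\<phi>\<close> turns convolution into
  multiplication by the symbol.\<close>

lemma symbol_kernel:
  fixes \<phi> :: "int^'d \<Rightarrow> complex"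
  assumes "\<And>a b. \<phi> (a + b) = \<phi> a * \<phi> b" "finite S" "finite {x. h x \<noteq> 0}"
    and "\<And>x. conv_op S Q h x = 0"
  shows "(\<Sum>a\<in>S. \<phi> a *s (Q a *v (\<Sum>x | h x \<noteq> 0. \<phi> x *s h x))) = 0"
proof -
  define F where "F = {x. h x \<noteq> 0}"
  \<comment> \<open>A common index set containing every translate of the support, so that the sums
    over \<open>a\<close> and over \<open>y\<close> can be exchanged.\<close>
  define G where "G = (\<Union>a\<in>S. (\<lambda>x. x + a) ` F)"
  have fG: "finite G" unfolding G_def F_def using assms by auto
  have "\<phi> a *s (Q a *v (\<Sum>x\<in>F. \<phi> x *s h x)) = (\<Sum>y\<in>G. \<phi> y *s (Q a *v h (y - a)))" if "a \<in> S" for a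
  proof -
    have "\<phi> a *s (Q a *v (\<Sum>x\<in>F. \<phi> x *s h x)) = (\<Sum>x\<in>F. \<phi> (x + a) *s (Q a *v h (x + a - a)))"
      unfolding matrix_vector_mult_lincomb vec.scale_sum_right assms(1)
      by (intro sum.cong refl) (simp add: mult.commute)
    also have "\<dots> = (\<Sum>y\<in>(\<lambda>x. x + a) ` F. \<phi> y *s (Q a *v h (y - a)))"
      by (subst sum.reindex) (auto simp: inj_on_def)
    also have "\<dots> = (\<Sum>y\<in>G. \<phi> y *s (Q a *v h (y - a)))"
    proof (rule sum.mono_neutral_left[OF fG])
      show "(\<lambda>x. x + a) ` F \<subseteq> G" using that by (auto simp: G_def)
      show "\<forall>i\<in>G - (\<lambda>x. x + a) ` F. \<phi> i *s (Q a *v h (i - a)) = 0"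
      proof
        fix i assume "i \<in> G - (\<lambda>x. x + a) ` F"
        moreover have "i \<in> (\<lambda>x. x + a) ` F" if "i - a \<in> F"
          by (rule image_eqI[OF _ that]) simp
        ultimately have "i - a \<notin> F" by blast
        then show "\<phi> i *s (Q a *v h (i - a)) = 0" by (simp add: F_def)
      qed
    qed
    finally show ?thesis .
  qed
  then have "(\<Sum>a\<in>S. \<phi> a *s (Q a *v (\<Sum>x\<in>F. \<phi> x *s h x))) = (\<Sum>a\<in>S. \<Sum>y\<in>G. \<phi> y *s (Q a *v h (y - a)))"
    by (rule sum.cong[OF refl])
  also have "\<dots> = (\<Sum>y\<in>G. \<phi> y *s conv_op S Q h y)"
    unfolding conv_op_def by (subst sum.swap) (simp add: vec.scale_sum_right)
  finally show ?thesis using assms(4) by (simp add: F_def)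
qed

lemma torus_nonzero: "z \<in> torus \<Longrightarrow> z $ j \<noteq> 0"
proof -
  assume "z \<in> torus"
  then have "norm (z $ j) = 1" by (simp add: torus_def)
  then show ?thesis by auto
qed

text \<open>If the symbol were invertible at \<open>z\<close>, it would be so nearby by continuity
  of the determinant. The transform of the finitely supported solution \<open>h\<close> would vanish
  there, and a trigonometric polynomial vanishing on an open set has zero coefficients, which gives
  \<open>h = 0\<close>.\<close>

lemma symbol_singular_of_ell2:
  fixes f :: "int^'d \<Rightarrow> complex^'n"
  assumes S: "finite S" and f: "f \<in> ell2" "f \<noteq> (\<lambda>_. 0)" "\<And>x. conv_op S Q f x = 0"
    and z: "z \<in> torus"
  shows "\<exists>v. v \<noteq> 0 \<and> (\<Sum>a\<in>S. zpow z a *s (Q a *v v)) = 0"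
proof (rule ccontr)
  assume no: "\<not> ?thesis"
  obtain h where h: "finite {x. h x \<noteq> 0}" "h \<noteq> (\<lambda>_. 0)" "\<And>x. conv_op S Q h x = 0"
    using finite_support_solution_of_ell2[OF S f] by blast
  \<comment> \<open>The symbol at the torus point with coordinates
    \<open>z $ j * cis (t $ j)\<close>.\<close>
  define M :: "real^'d \<Rightarrow> complex^'n^'n"
    where "M t = (\<chi> i k. \<Sum>a\<in>S. zpow z a * cis (idot t a) * Q a $ i $ k)" for t
  have M: "M t *v v = (\<Sum>a\<in>S. (zpow z a * cis (idot t a)) *s (Q a *v v))" for t v
    unfolding M_def vec_eq_iff matrix_vector_mult_def
    by (simp add: sum_distrib_left sum_distrib_right mult.assoc) (intro allI sum.swap)
  have det: "det (M t) \<noteq> 0 \<longleftrightarrow> (\<forall>v. M t *v v = 0 \<longrightarrow> v = 0)" for t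
    by (metis invertible_det_nz invertible_left_inverse matrix_left_invertible_ker)
  have "det (M 0) \<noteq> 0"
    unfolding det M using no by (auto simp: idot_def)
  moreover have "continuous_on UNIV (\<lambda>t. det (M t))"
    unfolding det_def M_def idot_def cis_conv_exp by (auto intro!: continuous_intros)
  ultimately have "\<forall>\<^sub>F t in at 0. det (M t) \<noteq> 0"
    by (intro tendsto_imp_eventually_ne) (auto simp: continuous_on_eq_continuous_at isCont_def)
  then obtain \<epsilon> where \<epsilon>: "\<epsilon> > 0" "\<And>t. t \<noteq> 0 \<Longrightarrow> dist t 0 < \<epsilon> \<Longrightarrow> det (M t) \<noteq> 0"
    unfolding eventually_at by auto
  define \<delta> where "\<delta> = \<epsilon> / CARD('d)"
  have \<delta>: "\<delta> > 0" using \<epsilon>(1) by (simp add: \<delta>_def)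
  have van: "(\<Sum>x | h x \<noteq> 0. (zpow z x * cis (idot t x)) *s h x) = 0" if t: "\<And>j. \<bar>t $ j\<bar> < \<delta>" for t
  proof -
    have "norm t \<le> (\<Sum>j\<in>UNIV. \<bar>t $ j\<bar>)" by (rule norm_le_l1_cart)
    also have "\<dots> < (\<Sum>j\<in>(UNIV::'d set). \<delta>)" using t by (intro sum_strict_mono) auto
    also have "\<dots> = \<epsilon>" by (simp add: \<delta>_def)
    finally have "det (M t) \<noteq> 0" using \<epsilon>(2)[of t] \<open>det (M 0) \<noteq> 0\<close> by (cases "t = 0") auto
    moreover have "M t *v (\<Sum>x | h x \<noteq> 0. (zpow z x * cis (idot t x)) *s h x) = 0"
      unfolding M using symbol_kernel[where \<phi> = "\<lambda>x. zpow z x * cis (idot t x)", OF _ S h(1,3)]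
      by (simp add: zpow_add torus_nonzero[OF z] idot_add_right cis_mult[symmetric] mult_ac)
    ultimately show ?thesis using det by blast
  qed
  have "h x = 0" for x
  proof (cases "h x = 0")
    case False
    have "zpow z x * h x $ i = 0" for i
    proof (rule trig_poly_vanish_local[where a = "\<lambda>x. zpow z x * h x $ i", OF h(1) \<delta>])
      fix t :: "real^'d" assume "\<And>j. \<bar>t $ j\<bar> < \<delta>"
      then have "(\<Sum>x | h x \<noteq> 0. (zpow z x * cis (idot t x)) *s h x) $ i = 0" by (simp add: van)
      then show "(\<Sum>x | h x \<noteq> 0. zpow z x * h x $ i * cis (idot t x)) = 0"
        by (simp add: mult_ac)
    qed (use False in simp)
    then show ?thesis using zpow_nonzero[OF torus_nonzero[OF z]] by (simp add: vec_eq_iff)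
  qed
  then show False using h(2) by auto
qed

section \<open>Singularity at roots of unity produces a solution\<close>

lemma zpow_mod:
  assumes "\<And>j. (z $ j) ^ N = 1"
  shows "zpow z (\<chi> j. x $ j mod int N) = zpow z x"
  unfolding zpow_def
proof (intro prod.cong refl)
  fix j
  have "N = 0 \<or> z $ j \<noteq> 0" using assms[of j] by (metis power_0_left zero_neq_one)
  then show "z $ j powi (\<chi> j. x $ j mod int N) $ j = z $ j powi x $ j"
  proof
    assume nz: "z $ j \<noteq> 0"
    have "z $ j powi (x $ j) = z $ j powi (int N * (x $ j div int N) + x $ j mod int N)" by simp
    also have "\<dots> = (z $ j powi int N) powi (x $ j div int N) * z $ j powi (x $ j mod int N)"
      using nz by (simp only: power_int_add power_int_mult simp_thms)
    finally show ?thesis using assms[of j] by simp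
  qed simp
qed

text \<open>The counting is applied to one plane wave per point of the grid of \<open>N\<close>-th
  roots of unity. Periodicity makes a relation on one box hold everywhere, so the waves are
  independent there; a layer with fewer than \<open>N ^ CARD('d)\<close> coordinates then
  suffices.\<close>

lemma ell2_solution_of_roots_of_unity:
  fixes S :: "(int^'d) set" and Q :: "int^'d \<Rightarrow> complex^'n^'n"
  assumes S: "finite S"
    and sing: "\<And>z N. odd N \<Longrightarrow> (\<And>j. (z $ j) ^ N = 1)
        \<Longrightarrow> \<exists>v. v \<noteq> 0 \<and> (\<Sum>a\<in>S. zpow z a *s (Q a *v v)) = 0"
  obtains f where "f \<in> ell2" "f \<noteq> (\<lambda>_. 0)" "\<And>x. conv_op S Q f x = 0"
proof -
  obtain R where R: "R \<ge> 0" "\<And>a j. a \<in> S \<Longrightarrow> \<bar>a $ j\<bar> \<le> R"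
    using finite_coord_bound[OF S] by blast
  obtain N :: nat where N: "odd N"
    "real (card (layer R (int N) :: (int^'d) set)) < 1 / CARD('n) * real N ^ CARD('d)"
    using small_layer[OF R(1), of "1 / CARD('n)"] by auto
  have Npos: "N > 0" using N(1) by (simp add: odd_pos)
  define B where "B = {z :: complex^'d. \<forall>j. z $ j \<in> {w. w ^ N = 1}}"
  have fB: "finite B" unfolding B_def
    using Npos by (intro finite_vec_box finite_roots_unity) auto
  have cB: "card B = N ^ CARD('d)" unfolding B_def card_vec_box
    using Npos by (simp add: card_roots_unity_eq)
  have nz: "z $ j \<noteq> 0" if "z \<in> B" for z j
    using that Npos by (auto simp: B_def power_0_left dest!: spec[of _ j])
  have "\<forall>z\<in>B. \<exists>v. v \<noteq> 0 \<and> (\<Sum>a\<in>S. zpow z a *s (Q a *v v)) = 0"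
    using sing[OF N(1)] by (auto simp: B_def)
  then obtain \<psi> where \<psi>: "\<And>z. z \<in> B \<Longrightarrow> \<psi> z \<noteq> 0"
      "\<And>z. z \<in> B \<Longrightarrow> (\<Sum>a\<in>S. zpow z a *s (Q a *v \<psi> z)) = 0"
    by metis
  \<comment> \<open>The minus sign matches the argument \<open>x - a\<close> in
    \<open>conv_op\<close>: the factor that comes out is \<open>zpow z a\<close>.\<close>
  define e where "e z x = zpow z (- x) *s \<psi> z" for z x
  have e0: "conv_op S Q (e z) x = 0" if "z \<in> B" for z x
  proof -
    have "conv_op S Q (e z) x = zpow z (- x) *s (\<Sum>a\<in>S. zpow z a *s (Q a *v \<psi> z))"
      unfolding conv_op_def e_def vec.scale_sum_right
      using zpow_add[of z "- x", OF nz[OF that]]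
      by (intro sum.cong) (auto simp: vector_scalar_commute)
    then show ?thesis using \<psi>(2)[OF that] by simp
  qed
  \<comment> \<open>The waves are independent on the box, so the identity matrix certifies the full
    rank \<open>card B\<close>.\<close>
  define A :: "complex^'d \<Rightarrow> complex^'d \<Rightarrow> complex" where "A z z' = (if z' = z then 1 else 0)" for z z'
  have "real (card (layer R (int N) :: (int^'d) set)) * CARD('n) < real N ^ CARD('d)"
    using N(2) by (simp add: field_simps)
  then have "real (card (layer R (int N) :: (int^'d) set)) * CARD('n) * real N ^ CARD('d) < (real N ^ CARD('d))\<^sup>2"
    using Npos unfolding power2_eq_square by (intro mult_strict_right_mono) auto
  moreover have "(\<Sum>x\<in>B. \<Sum>b\<in>B. (cmod (A x b))\<^sup>2) = real N ^ CARD('d)"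
  proof -
    have "(\<Sum>b\<in>B. (cmod (A x b))\<^sup>2) = 1" if "x \<in> B" for x
    proof -
      have "(\<Sum>b\<in>B. (cmod (A x b))\<^sup>2) = (\<Sum>b\<in>B. if b = x then 1 else 0)"
        by (intro sum.cong) (auto simp: A_def)
      then show ?thesis using fB that by simp
    qed
    then show ?thesis by (simp add: cB)
  qed
  moreover have "(\<Sum>x\<in>B. A x x) = of_real (real N ^ CARD('d))"
    by (simp add: A_def cB)
  ultimately have rank: "real (card (layer R (int N) :: (int^'d) set)) * CARD('n) * (\<Sum>x\<in>B. \<Sum>b\<in>B. (cmod (A x b))\<^sup>2)
      < (cmod (\<Sum>x\<in>B. A x x))\<^sup>2"
    by (simp add: norm_power)
  obtain f where f: "finite {x. f x \<noteq> 0}" "f \<noteq> (\<lambda>_. 0)" "\<And>x. conv_op S Q f x = 0"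
  proof (rule finite_support_solution[OF R(2) fB e0 rank])
    fix c b assume c: "\<And>x. x \<in> box 0 (int N) \<Longrightarrow> (\<Sum>z\<in>B. c z *s e z x) = 0" and b: "b \<in> B"
    obtain i where i: "\<psi> b $ i \<noteq> 0" using \<psi>(1)[OF b] by (auto simp: vec_eq_iff)
    have "c b * \<psi> b $ i = 0"
    proof (rule zpow_independent[where v = "\<lambda>z. c z * \<psi> z $ i", OF fB nz _ b])
      fix x :: "int^'d"
      \<comment> \<open>The representative of \<open>- x\<close> in the box; modulo \<open>N\<close>
        the exponent \<open>- y\<close> agrees with \<open>x\<close>.\<close>
      define y where "y = (\<chi> j. (- x) $ j mod int N)"
      have "y \<in> box 0 (int N)" using Npos by (simp add: box_def y_def)
      then have "(\<Sum>z\<in>B. c z *s e z y) $ i = 0" using c by simp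
      moreover have "zpow z (- y) = zpow z x" if "z \<in> B" for z
      proof -
        have "zpow z (- y) = zpow z (\<chi> j. (- y) $ j mod int N)"
          using that by (intro zpow_mod[symmetric]) (auto simp: B_def)
        also have "(\<chi> j. (- y) $ j mod int N) = (\<chi> j. x $ j mod int N)"
          by (simp add: y_def mod_minus_eq)
        also have "zpow z \<dots> = zpow z x"
          using that by (intro zpow_mod) (auto simp: B_def)
        finally show ?thesis .
      qed
      ultimately show "(\<Sum>z\<in>B. c z * \<psi> z $ i * zpow z x) = 0"
        unfolding e_def by (simp add: mult_ac cong: sum.cong)
    qed
    then have "c b = 0" using i by simp
    moreover have "(\<Sum>b'\<in>B. A b b' * c b') = (\<Sum>b'\<in>B. if b' = b then c b' else 0)"
      by (intro sum.cong) (auto simp: A_def)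
    ultimately show "(\<Sum>b'\<in>B. A b b' * c b') = 0" using fB b by simp
  qed auto
  have "f \<in> ell2"
  proof -
    have "(\<lambda>x. (norm (f x))\<^sup>2) summable_on {x. f x \<noteq> 0}" using f(1) by simp
    also have "?this \<longleftrightarrow> (\<lambda>x. (norm (f x))\<^sup>2) summable_on UNIV"
      by (rule summable_on_cong_neutral) auto
    finally show ?thesis by (simp add: ell2_def)
  qed
  then show ?thesis using that f by blast
qed

section \<open>Functional calculus of the resolution of unity and the Cayley transform\<close>

text \<open>When \<open>P\<close> resolves unity on \<open>S\<close>, this is the operator acting as
  the scalar \<open>g a\<close> on the range of \<open>P a\<close>, so identities between operators
  reduce to scalar ones.\<close>

definition spec_op :: "(int^'d) set \<Rightarrow> (int^'d \<Rightarrow> complex^'n^'n) \<Rightarrow> (int^'d \<Rightarrow> complex) \<Rightarrow> complex^'n \<Rightarrow> complex^'n" where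
  "spec_op S P g v = (\<Sum>a\<in>S. g a *s (P a *v v))"

lemma spec_op_mult:
  assumes "finite S" "resolution_of_unity S P"
  shows "spec_op S P g (spec_op S P h v) = spec_op S P (\<lambda>a. g a * h a) v"
  unfolding spec_op_def
proof (intro sum.cong refl)
  fix a assume a: "a \<in> S"
  have "P a *v (P b *v v) = (if b = a then P a *v v else 0)" if "b \<in> S" for b
    using assms(2) a that unfolding resolution_of_unity_def orth_proj_def
    by (auto simp: matrix_vector_mul_assoc)
  then have "P a *v (\<Sum>b\<in>S. h b *s (P b *v v)) = (\<Sum>b\<in>S. if b = a then h b *s (P a *v v) else 0)"
    unfolding matrix_vector_mult_lincomb by (intro sum.cong refl) auto
  then show "g a *s (P a *v (\<Sum>b\<in>S. h b *s (P b *v v))) = (g a * h a) *s (P a *v v)"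
    using assms(1) a by simp
qed

lemma spec_op_cong:
  "(\<And>a. a \<in> S \<Longrightarrow> g a = h a) \<Longrightarrow> spec_op S P g v = spec_op S P h v"
  unfolding spec_op_def by (intro sum.cong) auto

lemma spec_op_1:
  assumes "resolution_of_unity S P"
  shows "spec_op S P (\<lambda>_. 1) v = v"
proof -
  have "spec_op S P (\<lambda>_. 1) v = (\<Sum>a\<in>S. P a) *v v"
    unfolding spec_op_def by (simp add: matrix_vector_mult_def vec_eq_iff sum_distrib_right) (intro allI sum.swap)
  then show ?thesis using assms by (simp add: resolution_of_unity_def)
qed

lemma spec_op_add: "spec_op S P (\<lambda>a. g a + h a) v = spec_op S P g v + spec_op S P h v"
  unfolding spec_op_def by (simp add: vec.scale_left_distrib sum.distrib)

lemma spec_op_diff: "spec_op S P (\<lambda>a. g a - h a) v = spec_op S P g v - spec_op S P h v"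
  unfolding spec_op_def by (simp add: vec.scale_left_diff_distrib sum_subtractf)

lemma spec_op_0 [simp]: "spec_op S P g 0 = 0"
  unfolding spec_op_def by simp

lemma eta_spec_op: "eta S P z *v v = spec_op S P (\<lambda>a. (1 - zpow z a) / (1 + zpow z a)) v"
  unfolding eta_def spec_op_def vec_eq_iff matrix_vector_mult_def
  by (simp add: sum_distrib_left sum_distrib_right mult.assoc) (intro allI sum.swap)

lemma eta_condition_iff:
  fixes C :: "complex^'n^'n"
  assumes S: "finite S" "resolution_of_unity S P" and C: "C ** C = mat 1" and lam: "lam * lam = 1"
    and z: "z \<in> torus - Eset S"
  shows "(\<exists>\<psi>\<in>eigsp C lam. \<psi> \<noteq> 0 \<and> eta S P z *v \<psi> \<in> eigsp C (- lam))
    \<longleftrightarrow> (\<exists>v. v \<noteq> 0 \<and> spec_op S P (zpow z) (C *v v) = lam *s v)"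
proof
  have nz: "1 + zpow z a \<noteq> 0" if "a \<in> S" for a
    using z that by (auto simp: Eset_def add_eq_0_iff)
  \<comment> \<open>The Cayley map is an involution: with \<open>\<eta>\<close> for its value at
    \<open>w\<close>, \<open>w\<close> is recovered as \<open>(1 - \<eta>) / (1 + \<eta>)\<close>,
    here cleared of its denominator.\<close>
  have cayley: "w * (1 + (1 - w) / (1 + w)) = 1 - (1 - w) / (1 + w)" if "1 + w \<noteq> 0" for w :: complex
    using that by (simp add: divide_simps)
  have CC: "C *v (C *v v) = v" for v
    using C by (simp add: matrix_vector_mul_assoc)
  note mult = spec_op_mult[OF S] and one = spec_op_1[OF S(2)]
  show "\<exists>v. v \<noteq> 0 \<and> spec_op S P (zpow z) (C *v v) = lam *s v"
    if ex: "\<exists>\<psi>\<in>eigsp C lam. \<psi> \<noteq> 0 \<and> eta S P z *v \<psi> \<in> eigsp C (- lam)"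
  proof -
    obtain \<psi> where \<psi>: "C *v \<psi> = lam *s \<psi>" "\<psi> \<noteq> 0" "C *v (eta S P z *v \<psi>) = (- lam) *s (eta S P z *v \<psi>)"
      using ex unfolding eigsp_def by auto
    define \<phi> where "\<phi> = eta S P z *v \<psi>"
    define u where "u = \<psi> + \<phi>"
    have "u = spec_op S P (\<lambda>a. 1 + (1 - zpow z a) / (1 + zpow z a)) \<psi>"
      unfolding spec_op_add one u_def \<phi>_def eta_spec_op ..
    then have "spec_op S P (zpow z) u = spec_op S P (\<lambda>a. zpow z a * (1 + (1 - zpow z a) / (1 + zpow z a))) \<psi>"
      by (simp only: mult)
    also have "\<dots> = spec_op S P (\<lambda>a. 1 - (1 - zpow z a) / (1 + zpow z a)) \<psi>"
      by (intro spec_op_cong) (rule cayley, rule nz)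
    also have "\<dots> = \<psi> - \<phi>"
      unfolding spec_op_diff one \<phi>_def eta_spec_op ..
    finally have Vu: "spec_op S P (zpow z) u = \<psi> - \<phi>" .
    have "C *v u = lam *s \<psi> - lam *s \<phi>"
      unfolding u_def using \<psi>(1,3) by (simp add: \<phi>_def matrix_vector_right_distrib vec.scale_minus_left)
    then have "lam *s (C *v u) = \<psi> - \<phi>"
      by (simp add: vec.scale_right_diff_distrib lam)
    then have eq: "spec_op S P (zpow z) (C *v (C *v u)) = lam *s (C *v u)"
      by (simp add: CC Vu)
    have "C *v u \<noteq> 0"
    proof
      assume "C *v u = 0"
      then have "u = 0" using CC[of u] by simp
      have minus: "\<psi> - \<phi> = 0" using Vu unfolding \<open>u = 0\<close> by simp
      have plus: "\<psi> + \<phi> = 0" using \<open>u = 0\<close> unfolding u_def .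
      have "2 * \<psi> $ i = (\<psi> - \<phi>) $ i + (\<psi> + \<phi>) $ i" for i by simp
      then have "2 * \<psi> $ i = 0" for i by (simp only: minus plus zero_index add_0_left)
      then have "\<psi> = 0" by (simp add: vec_eq_iff)
      then show False using \<psi>(2) by simp
    qed
    with eq show ?thesis by blast
  qed
  show "\<exists>\<psi>\<in>eigsp C lam. \<psi> \<noteq> 0 \<and> eta S P z *v \<psi> \<in> eigsp C (- lam)"
    if ex: "\<exists>v. v \<noteq> 0 \<and> spec_op S P (zpow z) (C *v v) = lam *s v"
  proof -
    obtain v where v: "v \<noteq> 0" "spec_op S P (zpow z) (C *v v) = lam *s v"
      using ex by blast
    define u where "u = C *v v"
    have Cu: "C *v u = v" by (simp add: u_def CC)
    have Vu: "spec_op S P (zpow z) u = lam *s v" using v(2) by (simp add: u_def)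
    define \<psi> where "\<psi> = u + lam *s v"
    have \<psi>: "\<psi> = spec_op S P (\<lambda>a. 1 + zpow z a) u"
      unfolding spec_op_add one \<psi>_def Vu ..
    have "\<psi> \<noteq> 0"
    proof
      assume "\<psi> = 0"
      \<comment> \<open>Off the exceptional set the operator taking \<open>u\<close> to
        \<open>\<psi>\<close> is inverted by the one with symbol
        \<open>1 / (1 + zpow z a)\<close>.\<close>
      then have "0 = spec_op S P (\<lambda>a. 1 / (1 + zpow z a)) \<psi>" by simp
      also have "\<dots> = spec_op S P (\<lambda>a. 1 / (1 + zpow z a) * (1 + zpow z a)) u"
        unfolding \<psi> mult ..
      also have "\<dots> = spec_op S P (\<lambda>_. 1) u"
        using nz by (intro spec_op_cong) auto
      finally have "u = 0" by (simp add: one)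
      then show False using Cu v(1) by simp
    qed
    moreover have "\<psi> \<in> eigsp C lam"
      unfolding eigsp_def \<psi>_def
      by (simp add: matrix_vector_right_distrib vector_scalar_commute Cu u_def[symmetric]
          vec.scale_right_distrib lam)
    moreover have "eta S P z *v \<psi> = u - lam *s v"
    proof -
      have "eta S P z *v \<psi> = spec_op S P (\<lambda>a. (1 - zpow z a) / (1 + zpow z a) * (1 + zpow z a)) u"
        unfolding eta_spec_op \<psi> mult ..
      also have "\<dots> = spec_op S P (\<lambda>a. 1 - zpow z a) u"
        using nz by (intro spec_op_cong) auto
      also have "\<dots> = u - lam *s v"
        unfolding spec_op_diff one Vu ..
      finally show ?thesis .
    qed
    moreover have "u - lam *s v \<in> eigsp C (- lam)"
      unfolding eigsp_def
      by (simp add: matrix_vector_mult_diff_distrib vector_scalar_commute Cu u_def[symmetric]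
          vec.scale_right_diff_distrib lam)
    ultimately show ?thesis by auto
  qed
qed

section \<open>The walk as a convolution operator\<close>

text \<open>The eigenvalue is absorbed as a coefficient at lattice point 0. Two separate
  conditionals cover both cases, \<open>0 \<in> S\<close> and \<open>0 \<notin> S\<close>.\<close>

definition eig_coeff :: "(int^'d) set \<Rightarrow> (int^'d \<Rightarrow> complex^'n^'n) \<Rightarrow> complex^'n^'n \<Rightarrow> complex \<Rightarrow> int^'d \<Rightarrow> complex^'n^'n" where
  "eig_coeff S P C lam a = (if a \<in> S then P a ** C else 0) - (if a = 0 then mat lam else 0)"

lemma mat_vector_mult: "mat c *v v = c *s (v :: complex^'n)"
  by (simp add: vec_eq_iff matrix_vector_mult_def mat_def if_distrib [of "\<lambda>x. x * _"] cong: if_cong)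

text \<open>The generality serves two uses: \<open>k = 1\<close> with translates for
  \<open>g\<close> gives the operator, and \<open>k = zpow z\<close> with constant \<open>g\<close>
  gives its symbol.\<close>

lemma sum_eig_coeff:
  assumes "finite S"
  shows "(\<Sum>a\<in>insert 0 S. k a *s (eig_coeff S P C lam a *v g a))
    = (\<Sum>a\<in>S. k a *s (P a *v (C *v g a))) - k 0 *s (lam *s g 0)"
proof -
  have "k a *s (eig_coeff S P C lam a *v g a)
      = (if a \<in> S then k a *s (P a *v (C *v g a)) else 0) - (if a = 0 then k a *s (lam *s g a) else 0)" for a
    unfolding eig_coeff_def
    by (simp add: matrix_vector_mult_diff_rdistrib vec.scale_right_diff_distrib
        mat_vector_mult matrix_vector_mul_assoc)
  then have "(\<Sum>a\<in>insert 0 S. k a *s (eig_coeff S P C lam a *v g a))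
      = (\<Sum>a\<in>insert 0 S. if a \<in> S then k a *s (P a *v (C *v g a)) else 0)
        - (\<Sum>a\<in>insert 0 S. if a = 0 then k a *s (lam *s g a) else 0)"
    by (simp only: sum_subtractf)
  also have "(\<Sum>a\<in>insert 0 S. if a = 0 then k a *s (lam *s g a) else 0) = k 0 *s (lam *s g 0)"
    using assms by simp
  also have "(\<Sum>a\<in>insert 0 S. if a \<in> S then k a *s (P a *v (C *v g a)) else 0)
      = (\<Sum>a\<in>S. k a *s (P a *v (C *v g a)))"
    using assms by (intro sum.mono_neutral_cong_right) auto
  finally show ?thesis .
qed

lemma has_eigenvalue_iff_conv_op:
  assumes "finite S"
  shows "has_eigenvalue (qwalk S P C) lam \<longleftrightarrow>
    (\<exists>f\<in>ell2. f \<noteq> (\<lambda>_. 0) \<and> (\<forall>x. conv_op (insert 0 S) (eig_coeff S P C lam) f x = 0))"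
proof -
  have "conv_op (insert 0 S) (eig_coeff S P C lam) f x = qwalk S P C f x - lam *s f x" for f x
    using sum_eig_coeff[OF assms, of "\<lambda>_. 1" P C lam "\<lambda>a. f (x - a)"]
    by (simp add: conv_op_def qwalk_def shift_def)
  then show ?thesis unfolding has_eigenvalue_def fun_eq_iff by simp
qed

text \<open>Leaving out the exceptional set costs nothing: an eigenfunction makes the symbol
  singular on the whole torus, and the converse uses only roots of unity of odd order, which avoid
  that set.\<close>

lemma has_eigenvalue_iff_symbol:
  assumes S: "finite S"
  shows "has_eigenvalue (qwalk S P C) lam \<longleftrightarrow>
    (\<forall>z\<in>torus - Eset S. \<exists>v. v \<noteq> 0 \<and> spec_op S P (zpow z) (C *v v) = lam *s v)"
proof -
  have symb: "(\<Sum>a\<in>insert 0 S. zpow z a *s (eig_coeff S P C lam a *v v)) = 0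
      \<longleftrightarrow> spec_op S P (zpow z) (C *v v) = lam *s v" for z v
    using sum_eig_coeff[OF S, of "zpow z" P C lam "\<lambda>_. v"] by (simp add: spec_op_def)
  have fin: "finite (insert 0 S)" using S by simp
  show ?thesis
  proof
    assume "has_eigenvalue (qwalk S P C) lam"
    then obtain f where "f \<in> ell2" "f \<noteq> (\<lambda>_. 0)" "\<And>x. conv_op (insert 0 S) (eig_coeff S P C lam) f x = 0"
      unfolding has_eigenvalue_iff_conv_op[OF S] by blast
    from symbol_singular_of_ell2[OF fin this]
    show "\<forall>z\<in>torus - Eset S. \<exists>v. v \<noteq> 0 \<and> spec_op S P (zpow z) (C *v v) = lam *s v"
      unfolding symb by blast
  next
    assume *: "\<forall>z\<in>torus - Eset S. \<exists>v. v \<noteq> 0 \<and> spec_op S P (zpow z) (C *v v) = lam *s v"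
    have "\<exists>v. v \<noteq> 0 \<and> (\<Sum>a\<in>insert 0 S. zpow z a *s (eig_coeff S P C lam a *v v)) = 0"
      if "odd N" and z: "\<And>j. (z $ j) ^ N = 1" for z N
    proof -
      have "N > 0" using that(1) by (simp add: odd_pos)
      have "norm (z $ j) = 1" for j
        using z[of j] \<open>N > 0\<close> by (metis norm_ge_zero norm_one norm_power power_eq_1_iff less_not_refl)
      moreover have "zpow z a \<noteq> -1" for a
      proof
        assume "zpow z a = -1"
        \<comment> \<open>An \<open>N\<close>-th root of unity with \<open>N\<close> odd cannot be
          -1.\<close>
        moreover have "zpow z a ^ N = 1"
          unfolding zpow_def prod_power_distrib power_int_power'
          by (simp only: mult.commute[of _ "int N"] power_int_mult power_int_of_nat z power_int_1_left prod.neutral_const)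
        ultimately show False using \<open>odd N\<close> by simp
      qed
      ultimately show ?thesis using * unfolding symb by (auto simp: torus_def Eset_def)
    qed
    then obtain f where "f \<in> ell2" "f \<noteq> (\<lambda>_. 0)" "\<And>x. conv_op (insert 0 S) (eig_coeff S P C lam) f x = 0"
      using ell2_solution_of_roots_of_unity[OF fin] by blast
    then show "has_eigenvalue (qwalk S P C) lam"
      unfolding has_eigenvalue_iff_conv_op[OF S] by blast
  qed
qed

theorem theorem3p1:
  fixes S :: "(int^'d) set"
    and P :: "int^'d \<Rightarrow> complex^'n^'n"
    and C :: "complex^'n^'n"
  assumes "finite S"
    and "resolution_of_unity S P"
    and "unitary_mat C"
    and "C ** C = mat 1"
    and "\<forall>c::complex. C \<noteq> mat c"
  shows "(has_eigenvalue (qwalk S P C) 1 \<longleftrightarrow>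
           (\<forall>z\<in>torus - Eset S. \<exists>\<psi>\<in>eigsp C 1. \<psi> \<noteq> 0 \<and> eta S P z *v \<psi> \<in> eigsp C (-1)))
       \<and> (has_eigenvalue (qwalk S P C) (-1) \<longleftrightarrow>
           (\<forall>z\<in>torus - Eset S. \<exists>\<psi>\<in>eigsp C (-1). \<psi> \<noteq> 0 \<and> eta S P z *v \<psi> \<in> eigsp C 1))"
  using eta_condition_iff[OF assms(1,2,4), of 1] eta_condition_iff[OF assms(1,2,4), of "-1"]
  unfolding has_eigenvalue_iff_symbol[OF assms(1)] by simp

end
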